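(* Let $(X,\mathscr{A},\mu)$ be a probability measure space. Then $\mu$ is bounded away from zero if and only if $\mu$ is purely atomic and $(X,\mathscr{A},\mu)$ contains at most finitely many pairwise disjoint atoms (i.e. every family of pairwise disjoint atoms is finite).
   Context: A set $A\in\mathscr{A}$ is an atom of $\mu$ if $\mu(A)>0$ and for every $B\in\mathscr{A}$ either $\mu(A\cap B)=0$ or $\mu(A\setminus B)=0$. The measure $\mu$ is purely atomic if every $E\in\mathscr{A}$ with $\mu(E)>0$ contains an atom. The measure $\mu$ is bounded away from zero if there exists $\lambda>0$ such that for every $A\in\mathscr{A}$ either $\mu(A)=0$ or $\mu(A)\ge\lambda$. *)

theory Defs
  imports "HOL-Probability.Probability"
begin

definition measure_atom :: "'a measure \<Rightarrow> 'a set \<Rightarrow> bool" where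
  "measure_atom M A \<longleftrightarrow>
     A \<in> sets M \<and> emeasure M A > 0 \<and>
     (\<forall>B\<in>sets M. emeasure M (A \<inter> B) = 0 \<or> emeasure M (A - B) = 0)"

definition purely_atomic :: "'a measure \<Rightarrow> bool" where
  "purely_atomic M \<longleftrightarrow>
     (\<forall>E\<in>sets M. emeasure M E > 0 \<longrightarrow> (\<exists>A. measure_atom M A \<and> A \<subseteq> E))"

definition bounded_away_from_zero :: "'a measure \<Rightarrow> bool" where
  "bounded_away_from_zero M \<longleftrightarrow>
     (\<exists>l::real. l > 0 \<and> (\<forall>A\<in>sets M. emeasure M A = 0 \<or> emeasure M A \<ge> ennreal l))"

end

theory Submission
  imports Defs
begin

(* Below a gap l, a set of positive measure that is not an atom splits into two parts of measure
   at least l, so splitting must stop after finitely many steps, at an atom; disjoint atoms number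
   at most 1/l. Conversely, a maximal disjoint family of atoms (Zorn) is finite, and by pure
   atomicity its complement is null; hence every set of positive measure contains one of these atoms
   up to a null set, and the least of their measures is a gap. *)

context finite_measure
begin

text \<open>Since the measure is finite, it can be taken real-valued; this and the two lemmas after
  it move the definitions from \<open>emeasure\<close> to \<open>measure\<close>, where subtraction
  and linear arithmetic work.\<close>

lemma measure_atom_iff:
  "measure_atom M A \<longleftrightarrow> A \<in> sets M \<and> 0 < measure M A \<and>
     (\<forall>B\<in>sets M. measure M (A \<inter> B) = 0 \<or> measure M (A - B) = 0)"
  by (simp add: measure_atom_def emeasure_eq_measure)

lemma purely_atomic_iff:
  "purely_atomic M \<longleftrightarrow>
     (\<forall>E\<in>sets M. 0 < measure M E \<longrightarrow> (\<exists>A. measure_atom M A \<and> A \<subseteq> E))"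
  by (simp add: purely_atomic_def emeasure_eq_measure)

lemma bounded_away_from_zero_iff:
  "bounded_away_from_zero M \<longleftrightarrow>
     (\<exists>l>0. \<forall>A\<in>sets M. measure M A = 0 \<or> l \<le> measure M A)"
  by (simp add: bounded_away_from_zero_def emeasure_eq_measure)

text \<open>Induction on \<open>n\<close>, which bounds how many pieces of measure \<open>l\<close>
  fit into \<open>E\<close>. If \<open>E\<close> is not an atom, cutting off \<open>E - B\<close>
  costs at least \<open>l\<close>, so \<open>E \<inter> B\<close> satisfies the bound with one step
  fewer.\<close>

lemma atom_subset_of_gap:
  assumes gap: "\<And>A. A \<in> sets M \<Longrightarrow> measure M A = 0 \<or> l \<le> measure M A"
    and "E \<in> sets M" "0 < measure M E" "measure M E < real n * l"
  shows "\<exists>A. measure_atom M A \<and> A \<subseteq> E"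
  using assms(2-)
proof (induction n arbitrary: E)
  case 0
  \<comment> \<open>The bound would put the positive measure of \<open>E\<close> below 0.\<close>
  then show ?case by simp
next
  case (Suc n)
  show ?case
  proof (cases "measure_atom M E")
    case True
    then show ?thesis by blast
  next
    case False
    then obtain B where B: "B \<in> sets M" "measure M (E \<inter> B) \<noteq> 0" "measure M (E - B) \<noteq> 0"
      using Suc.prems by (auto simp: measure_atom_iff)
    have sets: "E \<inter> B \<in> sets M" "E - B \<in> sets M"
      using B Suc.prems by auto
    have "measure M E = measure M (E \<inter> B) + measure M (E - B)"
      using finite_measure_Union[OF sets] by (simp add: Int_Diff_Un Int_Diff_disjoint)
    moreover have "l \<le> measure M (E - B)"
      using gap[OF sets(2)] B by simp
    ultimately have "measure M (E \<inter> B) < real n * l"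
      using Suc.prems by (simp add: algebra_simps)
    moreover have "0 < measure M (E \<inter> B)"
      using B by (simp add: zero_less_measure_iff)
    ultimately show ?thesis
      using Suc.IH[OF sets(1)] by blast
  qed
qed

lemma purely_atomic_of_bounded_away_from_zero:
  assumes "bounded_away_from_zero M"
  shows "purely_atomic M"
proof -
  obtain l where l: "l > 0" "\<And>A. A \<in> sets M \<Longrightarrow> measure M A = 0 \<or> l \<le> measure M A"
    using assms by (auto simp: bounded_away_from_zero_iff)
  show ?thesis
    unfolding purely_atomic_iff
    \<comment> \<open>The Archimedean property supplies, for each \<open>E\<close>, some
      \<open>n\<close> with \<open>measure M E < real n * l\<close>.\<close>
    using atom_subset_of_gap[OF l(2)] reals_Archimedean3[OF l(1)] by blast
qed

lemma finite_disjoint_atoms_of_bounded_away_from_zero: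
  assumes "bounded_away_from_zero M" "\<forall>A\<in>F. measure_atom M A" "disjoint F"
  shows "finite F"
proof (rule ccontr)
  obtain l where l: "l > 0" "\<And>A. A \<in> sets M \<Longrightarrow> measure M A = 0 \<or> l \<le> measure M A"
    using assms(1) by (auto simp: bounded_away_from_zero_iff)
  \<comment> \<open>With this choice, \<open>n\<close> disjoint sets of measure at least
    \<open>l\<close> no longer fit into the space.\<close>
  obtain n :: nat where n: "measure M (space M) < real n * l"
    using reals_Archimedean3[OF l(1)] by blast
  assume "infinite F"
  then obtain G where G: "G \<subseteq> F" "finite G" "card G = n"
    using infinite_arbitrarily_large by blast
  have atom: "measure_atom M A" if "A \<in> G" for A
    using that G assms(2) by blast
  have "disjoint_family_on (\<lambda>A. A) G"
    using disjointD[OF assms(3)] G(1) by (auto simp: disjoint_family_on_def)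
  then have "(\<Sum>A\<in>G. measure M A) = measure M (\<Union>A\<in>G. A)"
    using G(2) atom by (intro finite_measure_finite_Union[symmetric]) (auto simp: measure_atom_iff)
  also have "\<dots> \<le> measure M (space M)"
    by (rule bounded_measure)
  finally have "(\<Sum>A\<in>G. measure M A) \<le> measure M (space M)" .
  moreover have "real (card G) * l \<le> (\<Sum>A\<in>G. measure M A)"
    using l(2) atom by (intro sum_bounded_below) (fastforce simp: measure_atom_iff)
  ultimately show False
    using n G(3) by simp
qed

text \<open>Zorn's lemma for inclusion. Maximality is stated as absorption of every atom disjoint
  from all members, the form in which it is applied to the complement of the union.\<close>

lemma exists_maximal_disjoint_atoms:
  "\<exists>F. (\<forall>A\<in>F. measure_atom M A) \<and> disjoint F \<and>
     (\<forall>A. measure_atom M A \<longrightarrow> (\<forall>B\<in>F. disjnt A B) \<longrightarrow> A \<in> F)"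
proof -
  let ?P = "{F. (\<forall>A\<in>F. measure_atom M A) \<and> disjoint F}"
  have "\<exists>F\<in>?P. \<forall>G\<in>?P. F \<subseteq> G \<longrightarrow> G = F"
  proof (rule subset_Zorn')
    fix C assume "subset.chain ?P C"
    then have "C \<subseteq> ?P" "chain\<^sub>\<subseteq> C"
      unfolding subset_chain_def chain_subset_def by blast+
    \<comment> \<open>Any two members of the union already lie together in one element of the
      chain.\<close>
    moreover from this have "disjoint (\<Union>C)"
      by (intro pairwise_chain_Union) auto
    ultimately show "\<Union> C \<in> ?P"
      by blast
  qed
  then obtain F where F: "F \<in> ?P" and max: "\<forall>G\<in>?P. F \<subseteq> G \<longrightarrow> G = F"
    by (elim bexE)
  have "A \<in> F" if A: "measure_atom M A" "\<forall>B\<in>F. disjnt A B" for A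
  proof -
    have "insert A F \<in> ?P"
      using A F by (auto simp: pairwise_insert disjnt_sym)
    from bspec[OF max this] have "insert A F = F"
      by (simp add: subset_insertI)
    then show ?thesis
      by blast
  qed
  then show ?thesis
    using F by blast
qed

lemma bounded_away_from_zero_of_finite_disjoint_atoms:
  assumes atomic: "purely_atomic M"
    and fin: "\<And>F. \<forall>A\<in>F. measure_atom M A \<Longrightarrow> disjoint F \<Longrightarrow> finite F"
  shows "bounded_away_from_zero M"
proof -
  obtain F where F: "\<forall>A\<in>F. measure_atom M A" "disjoint F"
    and max: "\<And>A. measure_atom M A \<Longrightarrow> \<forall>B\<in>F. disjnt A B \<Longrightarrow> A \<in> F"
    using exists_maximal_disjoint_atoms by blast
  have finF: "finite F"
    using fin F by blast
  have setsF: "A \<in> sets M" if "A \<in> F" for A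
    using F that by (auto simp: measure_atom_iff)
  \<comment> \<open>Finiteness of \<open>F\<close> enters here for measurability, and again below to
    make the minimum \<open>l\<close> positive.\<close>
  have UF: "\<Union>F \<in> sets M"
    using finF setsF by auto
  have null: "measure M (space M - \<Union>F) = 0"
  proof (rule ccontr)
    assume "measure M (space M - \<Union>F) \<noteq> 0"
    then obtain A where A: "measure_atom M A" "A \<subseteq> space M - \<Union>F"
      using atomic UF unfolding purely_atomic_iff
      by (metis sets.compl_sets zero_less_measure_iff)
    \<comment> \<open>An atom outside the union is absorbed by maximality, so it lies both in the
      union and in its complement.\<close>
    then have "A \<in> F"
      by (intro max) (auto simp: disjnt_def)
    then have "A = {}"
      using A(2) by blast
    then show False
      using A(1) by (simp add: measure_atom_iff)
  qed
  \<comment> \<open>The element 1 only guards against \<open>F\<close> being empty.\<close>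
  define l where "l = Min (insert 1 (measure M ` F))"
  have "l > 0"
    using finF F by (auto simp: l_def measure_atom_iff)
  moreover have "l \<le> measure M E" if E: "E \<in> sets M" "measure M E \<noteq> 0" for E
  proof -
    \<comment> \<open>Otherwise \<open>E\<close> would be covered by finitely many null traces and
      the null complement.\<close>
    have "\<exists>A\<in>F. measure M (A \<inter> E) \<noteq> 0"
    proof (rule ccontr)
      assume "\<not> ?thesis"
      then have "(\<Union>A\<in>F. A \<inter> E) \<in> null_sets M"
        using finF setsF E(1)
        by (intro null_sets_UN' countable_finite) (auto simp: null_sets_def emeasure_eq_measure)
      moreover have "space M - \<Union>F \<in> null_sets M"
        using null UF by (auto simp: null_sets_def emeasure_eq_measure)
      ultimately have "(\<Union>A\<in>F. A \<inter> E) \<union> (space M - \<Union>F) \<in> null_sets M"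
        by blast
      moreover have "E \<subseteq> (\<Union>A\<in>F. A \<inter> E) \<union> (space M - \<Union>F)"
        using sets.sets_into_space[OF E(1)] by auto
      ultimately have "E \<in> null_sets M"
        using null_sets_subset E(1) by blast
      then show False
        using E(2) by (simp add: null_sets_def emeasure_eq_measure)
    qed
    then obtain A where A: "A \<in> F" "measure M (A \<inter> E) \<noteq> 0"
      by blast
    \<comment> \<open>The atom dichotomy puts all the mass of \<open>A\<close> into
      \<open>E\<close>, whence \<open>E\<close> has measure at least that of
      \<open>A\<close>.\<close>
    then have "measure M (A - E) = 0"
      using F(1) E(1) by (auto simp: measure_atom_iff)
    moreover have "measure M A = measure M (A \<inter> E) + measure M (A - E)"
      using finite_measure_Union[of "A \<inter> E" "A - E"] setsF[OF A(1)] E(1)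
      by (simp add: Int_Diff_Un Int_Diff_disjoint)
    moreover have "measure M (A \<inter> E) \<le> measure M E"
      using E(1) by (intro finite_measure_mono) auto
    moreover have "l \<le> measure M A"
      using finF A(1) by (auto simp: l_def)
    ultimately show ?thesis
      by linarith
  qed
  ultimately show ?thesis
    unfolding bounded_away_from_zero_iff by blast
qed

end

theorem theorem2p10:
  fixes M :: "'a measure"
  assumes "prob_space M"
  shows "bounded_away_from_zero M \<longleftrightarrow>
    purely_atomic M \<and>
    (\<forall>F. (\<forall>A\<in>F. measure_atom M A) \<and> disjoint F \<longrightarrow> finite F)"
proof -
  interpret prob_space M by fact
  show ?thesis
    using purely_atomic_of_bounded_away_from_zero
      finite_disjoint_atoms_of_bounded_away_from_zero
      bounded_away_from_zero_of_finite_disjoint_atoms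
    by blast
qed

end
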